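(* Let $n\ge 1$, let $\Gamma\in\mathbb{R}^{2n\times 2n}$ be symmetric positive definite, $\gamma\in\mathbb{R}^{2n}$, $a\in\mathbb{R}$, and $J(x)=\tfrac12 x^{T}\Gamma x+\gamma^{T}x+a$. Let $\mathcal{U}\subseteq\mathbb{R}^{2n}$ be a non-empty closed set and let $\alpha$ be a step size with $0<\alpha\le 1/\rho(\Gamma)$. Let $(x_k)_{k\ge1}$ (requested setpoints) and $(y_k)_{k\ge 1}$ (implemented setpoints) be sequences in $\mathbb{R}^{2n}$ such that for all $k\ge 1$ $$x_{k+1}=\mathrm{proj}_{\mathcal{U}}\bigl(y_k-\alpha\nabla J(y_k)\bigr)\quad\text{and}\quad y_k-\alpha\nabla J(y_k)\in\mathcal{U}.$$ Write $x_k=(u^{\mathrm{req}}_{k,1},\dots,u^{\mathrm{req}}_{k,n})$ and $y_k=(u^{\mathrm{imp}}_{k,1},\dots,u^{\mathrm{imp}}_{k,n})$ with $u^{\mathrm{req}}_{k,i},u^{\mathrm{imp}}_{k,i}\in\mathbb{R}^2$. Suppose that for every $i\in\{1,\dots,n\}$ resource agent $i$ has $c_i$-bounded accumulated-error (with $0\le c_i<\infty$), i.e. $\bigl\|\sum_{j=1}^k(u^{\mathrm{imp}}_{j,i}-u^{\mathrm{req}}_{j,i})\bigr\|\le c_i$ for all $k\ge1$, and let $c=(c_1,\dots,c_n)\in\mathbb{R}^n$. Then $$\lim_{k\to\infty}\frac1k\sum_{i=1}^k y_i=x^*,\qquad x^*:=\arg\min_x J(x)=-\Gamma^{-1}\gamma.$$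 Moreover, for every $k\ge1$, $$\Bigl\|\frac1k\sum_{i=1}^k y_i-x^*\Bigr\|\le\frac{1-r^k}{k(1-r)}\Bigl(\|\psi\|+\|\Gamma^{-1}\|\,\|\gamma\|\,r^2+\|c\|\Bigr),$$ where $r:=\rho(I-\alpha\Gamma)<1$ and $\psi:=x_1+2\alpha\gamma-\alpha^2\Gamma\gamma$.
   Context: $\|\cdot\|$ is the Euclidean norm for vectors and the induced $\ell_2$ operator norm for matrices; $\rho(\cdot)$ is the spectral radius. $\mathrm{proj}_{\mathcal{U}}$ denotes a projection operator onto $\mathcal{U}$: a map sending each $x$ to some point of $\mathcal{U}$ at minimal Euclidean distance from $x$. The setting models a grid agent controlling $n$ resource agents by a gradient step from the perfectly known state $y_k$, with a fixed quadratic objective $J$ and inactive projection. *)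

theory Defs
  imports "HOL-Analysis.Analysis"
begin

text \<open>Vectors in \<open>\<real>\<^sup>2\<^sup>n\<close> are rendered as \<open>real ^ ('n \<times> 2)\<close> with \<open>n = CARD('n)\<close>; the pair
  \<open>(i, l)\<close> is the \<open>l\<close>-th coordinate of the \<open>i\<close>-th agent, so that \<open>block i v\<close> is the
  component of \<open>v\<close> belonging to agent \<open>i\<close>.\<close>

definition block :: "'n::finite \<Rightarrow> real ^ ('n \<times> 2) \<Rightarrow> real ^ 2" where
  "block i v = (\<chi> l. v $ (i, l))"

definition symmetric_positive_definite :: "real ^ 'm ^ 'm \<Rightarrow> bool" where
  "symmetric_positive_definite M \<longleftrightarrow>
     transpose M = M \<and> (\<forall>x. x \<noteq> 0 \<longrightarrow> x \<bullet> (M *v x) > 0)"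

text \<open>The spectrum consists of all complex eigenvalues, also for a real matrix.\<close>

definition spectrum :: "real ^ 'm ^ 'm \<Rightarrow> complex set" where
  "spectrum M = {z. \<exists>v. v \<noteq> 0 \<and> map_matrix complex_of_real M *v v = z *s v}"

definition spectral_radius :: "real ^ 'm ^ 'm \<Rightarrow> real" where
  "spectral_radius M = Max (norm ` spectrum M)"

definition op_norm :: "real ^ 'm ^ 'k \<Rightarrow> real" where
  "op_norm M = onorm ((*v) M)"

definition quadratic_objective ::
    "real ^ 'm ^ 'm \<Rightarrow> real ^ 'm \<Rightarrow> real \<Rightarrow> real ^ 'm \<Rightarrow> real" where
  "quadratic_objective \<Gamma> \<gamma> a x = (1 / 2) * (x \<bullet> (\<Gamma> *v x)) + \<gamma> \<bullet> x + a"

text \<open>Meaningful only where \<open>f\<close> is differentiable.\<close>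

definition gradient :: "('a::real_inner \<Rightarrow> real) \<Rightarrow> 'a \<Rightarrow> 'a" where
  "gradient f x = (THE g. GDERIV f x :> g)"

text \<open>The set \<open>U\<close> need not be convex, so a nearest point need not be unique: \<open>P\<close> may be
  any selection of nearest points.\<close>

definition projection_onto :: "'a::metric_space set \<Rightarrow> ('a \<Rightarrow> 'a) \<Rightarrow> bool" where
  "projection_onto U P \<longleftrightarrow> (\<forall>x. P x \<in> U \<and> (\<forall>u\<in>U. dist x (P x) \<le> dist x u))"

definition bounded_accumulated_error ::
    "real \<Rightarrow> (nat \<Rightarrow> 'a::real_normed_vector) \<Rightarrow> (nat \<Rightarrow> 'a) \<Rightarrow> bool" where
  "bounded_accumulated_error c imp req \<longleftrightarrow> (\<forall>k\<ge>1. norm (\<Sum>j=1..k. imp j - req j) \<le> c)"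

end

(* With A = I - \<alpha>\<Gamma> the inactive projection turns the update into the affine recursion
   y (k+1) = A (y k) - \<alpha>\<gamma> + (y (k+1) - x (k+1)), whose unperturbed fixed point is xstar.
   Summing it telescopes the implementation errors: S k = (\<Sum>i\<le>k. y i - xstar) satisfies
   S (k+1) = A (S k) + (x 1 - xstar) + E (k+1), where E is the accumulated error, of norm at
   most norm c. Since A is symmetric, its operator norm is r, so S k is bounded by a geometric
   sum. The constant comes from the identity x 1 - xstar = \<psi> + A\<^sup>2 \<Gamma>\<^sup>-\<^sup>1 \<gamma>. *)
theory Submission
  imports Defs
begin

section \<open>Spectral radius of a symmetric real matrix\<close>

lemma symmetric_matrix_inner:
  fixes M :: "real ^ 'm ^ 'm"
  assumes "transpose M = M"
  shows "(M *v x) \<bullet> y = x \<bullet> (M *v y)"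
  by (metis assms dot_lmul_matrix transpose_matrix_vector)

text \<open>Real eigenvectors are the working notion, while \<open>spectrum\<close> is complex; for
  symmetric matrices the two are matched below.\<close>

definition real_eigenvalue :: "real ^ 'm ^ 'm \<Rightarrow> real \<Rightarrow> bool" where
  "real_eigenvalue M l \<longleftrightarrow> (\<exists>v. v \<noteq> 0 \<and> M *v v = l *\<^sub>R v)"

lemma real_eigenvalue_in_spectrum:
  assumes "real_eigenvalue M l"
  shows "complex_of_real l \<in> spectrum M"
proof -
  obtain v where v: "v \<noteq> 0" "M *v v = l *\<^sub>R v"
    using assms by (auto simp: real_eigenvalue_def)
  define w :: "complex ^ 'a" where "w = (\<chi> i. of_real (v $ i))"
  have "w \<noteq> 0"
    using v(1) by (auto simp: w_def vec_eq_iff)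
  moreover have "map_matrix complex_of_real M *v w = of_real l *s w"
  proof -
    have "(\<Sum>j\<in>UNIV. M $ i $ j * v $ j) = l * v $ i" for i
      using v(2) by (simp add: vec_eq_iff matrix_vector_mult_def)
    then show ?thesis
      by (simp add: vec_eq_iff matrix_vector_mult_def w_def flip: of_real_mult of_real_sum)
  qed
  ultimately show ?thesis
    unfolding spectrum_def by blast
qed

text \<open>Split a complex eigenvector into real and imaginary parts \<open>p\<close> and
  \<open>q\<close>. Symmetry tested on this pair forces \<open>Im z\<close> to vanish, and whichever
  of \<open>p\<close>, \<open>q\<close> is nonzero is then a real eigenvector.\<close>

lemma spectrum_symmetric_real:
  fixes M :: "real ^ 'm ^ 'm"
  assumes sym: "transpose M = M" and z: "z \<in> spectrum M"
  obtains l where "z = of_real l" "real_eigenvalue M l"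
proof -
  obtain v where v: "v \<noteq> 0" "map_matrix complex_of_real M *v v = z *s v"
    using z by (auto simp: spectrum_def)
  define p where "p = (\<chi> i. Re (v $ i))"
  define q where "q = (\<chi> i. Im (v $ i))"
  have entry: "(\<Sum>j\<in>UNIV. of_real (M $ i $ j) * v $ j) = z * v $ i" for i
    using v(2) by (simp add: vec_eq_iff matrix_vector_mult_def)
  have Mp: "M *v p = Re z *\<^sub>R p - Im z *\<^sub>R q"
    using arg_cong[OF entry, of Re]
    by (simp add: vec_eq_iff matrix_vector_mult_def p_def q_def)
  have Mq: "M *v q = Im z *\<^sub>R p + Re z *\<^sub>R q"
    using arg_cong[OF entry, of Im]
    by (simp add: vec_eq_iff matrix_vector_mult_def p_def q_def add.commute)
  have nz: "p \<noteq> 0 \<or> q \<noteq> 0"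
    using v(1) by (auto simp: vec_eq_iff p_def q_def complex_eq_iff)
  have "Im z * (p \<bullet> p + q \<bullet> q) = 0"
    using symmetric_matrix_inner[OF sym, of p q]
    by (simp add: Mp Mq algebra_simps inner_commute)
  moreover have "p \<bullet> p + q \<bullet> q > 0"
    using nz by (metis add_pos_nonneg add_nonneg_pos inner_ge_zero inner_gt_zero_iff)
  ultimately have "Im z = 0"
    by simp
  then have "M *v p = Re z *\<^sub>R p" "M *v q = Re z *\<^sub>R q" "z = of_real (Re z)"
    using Mp Mq by (simp_all add: complex_eq_iff)
  with nz show ?thesis
    using that unfolding real_eigenvalue_def by blast
qed

text \<open>Eigenvectors of distinct eigenvalues are orthogonal, so choosing one per eigenvalue
  gives an independent, hence finite, family. Finiteness makes the \<open>Max\<close> in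
  \<open>spectral_radius\<close> meaningful.\<close>

lemma finite_real_eigenvalues:
  fixes M :: "real ^ 'm ^ 'm"
  assumes sym: "transpose M = M"
  shows "finite {l. real_eigenvalue M l}"
proof -
  have "\<exists>f. \<forall>l\<in>{l. real_eigenvalue M l}. f l \<noteq> 0 \<and> M *v f l = l *\<^sub>R f l"
    by (rule bchoice) (auto simp: real_eigenvalue_def)
  then obtain f where f: "\<And>l. real_eigenvalue M l \<Longrightarrow> f l \<noteq> 0"
      "\<And>l. real_eigenvalue M l \<Longrightarrow> M *v f l = l *\<^sub>R f l"
    by blast
  have orth: "f l \<bullet> f m = 0" if "real_eigenvalue M l" "real_eigenvalue M m" "l \<noteq> m" for l m
    using symmetric_matrix_inner[OF sym, of "f l" "f m"] that by (simp add: f)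
  have "pairwise orthogonal (f ` {l. real_eigenvalue M l})"
    unfolding pairwise_def orthogonal_def using orth by blast
  then have "independent (f ` {l. real_eigenvalue M l})"
    using f by (intro pairwise_orthogonal_independent) auto
  then have "finite (f ` {l. real_eigenvalue M l})"
    by (rule independent_imp_finite)
  moreover have "inj_on f {l. real_eigenvalue M l}"
    by (rule inj_onI) (metis f(1) inner_eq_zero_iff mem_Collect_eq orth)
  ultimately show ?thesis
    by (rule finite_imageD)
qed

text \<open>By compactness \<open>norm (M *v x)\<close> has a maximum s on the unit sphere. A
  maximiser v satisfies (M - s)(M + s) v = 0, so s or -s is an eigenvalue. This also shows that a
  real eigenvalue exists at all.\<close>

lemma symmetric_norm_eigenvalue:
  fixes M :: "real ^ 'm ^ 'm"
  assumes sym: "transpose M = M"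
  obtains l where "real_eigenvalue M l" "\<And>x. norm (M *v x) \<le> \<bar>l\<bar> * norm x"
proof -
  have "continuous_on (sphere 0 1) (\<lambda>x. norm (M *v x))"
    by (intro continuous_on_norm linear_continuous_on) auto
  moreover have "sphere (0 :: real ^ 'm) 1 \<noteq> {}"
    by simp
  ultimately obtain v where v: "norm v = 1" "\<And>x. norm x = 1 \<Longrightarrow> norm (M *v x) \<le> norm (M *v v)"
    using continuous_attains_sup[OF compact_sphere, of 0 1 "\<lambda>x. norm (M *v x)"] by fastforce
  define s where "s = norm (M *v v)"
  have bound: "norm (M *v x) \<le> s * norm x" for x
  proof (cases "x = 0")
    case False
    then have "norm (M *v (x /\<^sub>R norm x)) \<le> s"
      unfolding s_def by (intro v(2)) simp
    with False show ?thesis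
      by (simp add: matrix_vector_mult_scaleR field_simps)
  qed simp
  \<comment> \<open>Equality case of Cauchy--Schwarz: a maximiser of the norm is an eigenvector of the square.\<close>
  define w where "w = M *v (M *v v)"
  have wv: "w \<bullet> v = s\<^sup>2"
    unfolding w_def s_def by (simp add: symmetric_matrix_inner[OF sym] power2_norm_eq_inner)
  have "norm w \<le> s * s"
    using bound[of "M *v v"] by (simp add: w_def s_def)
  then have "w \<bullet> w \<le> (s * s)\<^sup>2"
    by (metis norm_ge_zero power2_norm_eq_inner power_mono)
  moreover have "(w - s\<^sup>2 *\<^sub>R v) \<bullet> (w - s\<^sup>2 *\<^sub>R v) = w \<bullet> w - 2 * s\<^sup>2 * (w \<bullet> v) + s ^ 4 * (v \<bullet> v)"
    by (simp add: inner_diff_left inner_diff_right inner_commute power2_eq_square power4_eq_xxxx algebra_simps)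
  moreover have "v \<bullet> v = 1"
    using v(1) by (simp add: norm_eq_1)
  ultimately have "(w - s\<^sup>2 *\<^sub>R v) \<bullet> (w - s\<^sup>2 *\<^sub>R v) \<le> 0"
    by (simp add: wv power2_eq_square power4_eq_xxxx)
  then have weq: "w = s\<^sup>2 *\<^sub>R v"
    by (metis eq_iff_diff_eq_0 inner_eq_zero_iff inner_ge_zero order_antisym)
  have v0: "v \<noteq> 0"
    using v(1) by auto
  \<comment> \<open>From M (M v) = s^2 v it follows that M u = s u; if u = 0, then v itself is an
    eigenvector for -s.\<close>
  define u where "u = M *v v + s *\<^sub>R v"
  have "real_eigenvalue M s \<or> real_eigenvalue M (- s)"
  proof (cases "u = 0")
    case True
    then have "M *v v = (- s) *\<^sub>R v"
      by (simp add: u_def add_eq_0_iff2)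
    with v0 show ?thesis
      unfolding real_eigenvalue_def by blast
  next
    case False
    have "M *v u = s *\<^sub>R u"
      by (simp add: u_def matrix_vector_right_distrib matrix_vector_mult_scaleR
          scaleR_add_right weq[unfolded w_def] power2_eq_square)
    with False show ?thesis
      unfolding real_eigenvalue_def by blast
  qed
  moreover have "\<bar>s\<bar> = s"
    by (simp add: s_def)
  ultimately show ?thesis
    using that bound by (metis abs_minus_cancel)
qed

text \<open>The moduli of the spectrum form a finite nonempty set, so the \<open>Max\<close> is
  attained and dominates the eigenvalue that bounds the operator norm.\<close>

lemma spectral_radius_symmetric:
  fixes M :: "real ^ 'm ^ 'm"
  assumes sym: "transpose M = M"
  shows real_eigenvalue_le_spectral_radius: "real_eigenvalue M l \<Longrightarrow> \<bar>l\<bar> \<le> spectral_radius M"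
    and spectral_radius_attained: "\<exists>l. real_eigenvalue M l \<and> spectral_radius M = \<bar>l\<bar>"
    and norm_le_spectral_radius: "norm (M *v x) \<le> spectral_radius M * norm x"
proof -
  have "spectrum M = of_real ` {l. real_eigenvalue M l}"
    using real_eigenvalue_in_spectrum spectrum_symmetric_real[OF sym] by blast
  then have eq: "norm ` spectrum M = abs ` {l. real_eigenvalue M l}"
    by (simp add: image_image)
  have fin: "finite (norm ` spectrum M)"
    unfolding eq using finite_real_eigenvalues[OF sym] by simp
  obtain m where m: "real_eigenvalue M m" "\<And>x. norm (M *v x) \<le> \<bar>m\<bar> * norm x"
    using symmetric_norm_eigenvalue[OF sym] by metis
  show le: "\<bar>l\<bar> \<le> spectral_radius M" if "real_eigenvalue M l" for l
    unfolding spectral_radius_def using that eq by (intro Max_ge[OF fin]) auto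
  have "spectral_radius M \<in> norm ` spectrum M"
    unfolding spectral_radius_def using m(1) eq by (intro Max_in[OF fin]) auto
  then show "\<exists>l. real_eigenvalue M l \<and> spectral_radius M = \<bar>l\<bar>"
    unfolding eq by auto
  show "norm (M *v x) \<le> spectral_radius M * norm x"
    using m(2)[of x] le[OF m(1)] by (meson mult_right_mono norm_ge_zero order_trans)
qed

section \<open>Quadratic objectives\<close>

text \<open>\<open>matrix_inv\<close> is a choice, so an inverse must first be shown to exist;
  definiteness gives a trivial kernel, which suffices for a square matrix.\<close>

lemma symmetric_positive_definite_mult_matrix_inv:
  fixes M :: "real ^ 'm ^ 'm"
  assumes "symmetric_positive_definite M"
  shows "M *v (matrix_inv M *v x) = x"
proof -
  have "\<forall>x. M *v x = 0 \<longrightarrow> x = 0"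
    using assms unfolding symmetric_positive_definite_def by (metis inner_zero_right less_irrefl)
  then have "\<exists>B. M ** B = mat 1 \<and> B ** M = mat 1"
    using matrix_left_invertible_ker matrix_left_right_inverse by metis
  then have "M ** matrix_inv M = mat 1"
    unfolding matrix_inv_def by (rule someI2_ex) simp
  then show ?thesis
    by (simp add: matrix_vector_mul_assoc)
qed

lemma gradient_eqI:
  assumes "GDERIV f x :> g"
  shows "gradient f x = g"
  unfolding gradient_def
proof (rule the_equality)
  fix h assume "GDERIV f x :> h"
  with assms have "(\<lambda>u. u \<bullet> g) = (\<lambda>u. u \<bullet> h)"
    unfolding gderiv_def by (rule has_derivative_unique)
  then show "h = g"
    by (metis inner_commute vector_eq_rdot)
qed (fact assms)

lemma gradient_quadratic_objective:
  fixes M :: "real ^ 'm ^ 'm"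
  assumes sym: "transpose M = M"
  shows "gradient (quadratic_objective M g a) x = M *v x + g"
proof (rule gradient_eqI)
  have "((*v) M has_derivative (*v) M) (at x)"
    by (rule bounded_linear_imp_has_derivative) simp
  then have "(quadratic_objective M g a has_derivative
      (\<lambda>h. (1 / 2) * (x \<bullet> (M *v h) + h \<bullet> (M *v x)) + g \<bullet> h)) (at x)"
    unfolding quadratic_objective_def by (auto intro!: derivative_eq_intros)
  \<comment> \<open>Symmetry merges the two product-rule terms and so cancels the factor
    1/2.\<close>
  moreover have "x \<bullet> (M *v h) = h \<bullet> (M *v x)" for h
    by (metis inner_commute sym symmetric_matrix_inner)
  ultimately show "GDERIV (quadratic_objective M g a) x :> M *v x + g"
    unfolding gderiv_def by (simp add: inner_add_right inner_commute[of g])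
qed

text \<open>The expansion is around the stationary point \<open>s\<close>, where the first-order
  term vanishes.\<close>

lemma quadratic_objective_complete_square:
  fixes M :: "real ^ 'm ^ 'm"
  assumes sym: "transpose M = M" and s: "M *v s = - g"
  shows "quadratic_objective M g a z =
    quadratic_objective M g a s + (1 / 2) * ((z - s) \<bullet> (M *v (z - s)))"
proof -
  have g: "g = - (M *v s)"
    using s by simp
  have "s \<bullet> (M *v z) = (M *v s) \<bullet> z" "z \<bullet> (M *v s) = (M *v s) \<bullet> z" "s \<bullet> (M *v s) = (M *v s) \<bullet> s"
    by (simp_all only: symmetric_matrix_inner[OF sym] inner_commute[of z])
  then show ?thesis
    by (simp add: quadratic_objective_def g matrix_vector_mult_diff_distrib
        inner_diff_left inner_diff_right algebra_simps)
qed

lemma is_arg_min_quadratic_objective: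
  fixes M :: "real ^ 'm ^ 'm"
  assumes "symmetric_positive_definite M" and s: "M *v s = - g"
  shows "is_arg_min (quadratic_objective M g a) (\<lambda>_. True) z \<longleftrightarrow> z = s"
proof -
  note sq = quadratic_objective_complete_square[OF _ s, of a]
  have sym: "transpose M = M" and pos: "\<And>x. x \<noteq> 0 \<Longrightarrow> x \<bullet> (M *v x) > 0"
    using assms(1) by (auto simp: symmetric_positive_definite_def)
  have less: "quadratic_objective M g a s < quadratic_objective M g a u" if "u \<noteq> s" for u
    using pos[of "u - s"] sq[OF sym, of u] that by simp
  then show ?thesis
    unfolding is_arg_min_def by (metis less_asym less_irrefl)
qed

section \<open>Error recursion\<close>

text \<open>A point of \<open>U\<close> has distance 0 to itself, so every selection of nearest
  points returns it, whatever the shape of \<open>U\<close>.\<close>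

lemma projection_onto_fixes:
  assumes "projection_onto U P" "u \<in> U"
  shows "P u = u"
  using assms unfolding projection_onto_def by (metis dist_self dist_le_zero_iff)

lemma sum_norm_block_power2: "(\<Sum>i\<in>UNIV. (norm (block i v))\<^sup>2) = (norm v)\<^sup>2"
proof -
  have "(\<Sum>i\<in>UNIV. (norm (block i v))\<^sup>2) = (\<Sum>i\<in>UNIV. \<Sum>l\<in>UNIV. v $ (i, l) * v $ (i, l))"
    by (simp add: block_def power2_norm_eq_inner inner_vec_def)
  also have "\<dots> = (\<Sum>p\<in>UNIV. v $ p * v $ p)"
    by (simp add: sum.cartesian_product)
  also have "\<dots> = (norm v)\<^sup>2"
    by (simp add: power2_norm_eq_inner inner_vec_def)
  finally show ?thesis .
qed

text \<open>Squared block norms add up to the squared norm; this turns the bounds per agent into one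
  bound by the norm of \<open>c\<close>.\<close>

lemma norm_le_of_blocks:
  fixes c :: "real ^ 'n"
  assumes "\<And>i. norm (block i v) \<le> c $ i"
  shows "norm v \<le> norm c"
proof (rule power2_le_imp_le)
  have "(norm v)\<^sup>2 \<le> (\<Sum>i\<in>UNIV. (c $ i)\<^sup>2)"
    unfolding sum_norm_block_power2[symmetric]
    using assms by (intro sum_mono power_mono) auto
  also have "\<dots> = (norm c)\<^sup>2"
    unfolding power2_norm_eq_inner by (simp add: inner_vec_def power2_eq_square)
  finally show "(norm v)\<^sup>2 \<le> (norm c)\<^sup>2" .
qed simp

lemma block_sum: "block i (sum f A) = (\<Sum>j\<in>A. block i (f j))"
  by (simp add: block_def vec_eq_iff)

lemma block_diff: "block i (u - v) = block i u - block i v"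
  by (simp add: block_def vec_eq_iff)

text \<open>Each step multiplies the accumulated geometric sum by r and adds one fresh term
  \<open>B\<close>; starting from 0 leaves no transient.\<close>

lemma perturbed_contraction_bound:
  fixes S w :: "nat \<Rightarrow> 'a::real_normed_vector"
  assumes "0 \<le> r" and f: "\<And>v. norm (f v) \<le> r * norm v"
    and "S 0 = 0" and S: "\<And>k. S (Suc k) = f (S k) + w k" and w: "\<And>k. norm (w k) \<le> B"
  shows "norm (S k) \<le> (\<Sum>j<k. r ^ j) * B"
proof (induction k)
  case (Suc k)
  have "norm (S (Suc k)) \<le> norm (f (S k)) + norm (w k)"
    unfolding S by (rule norm_triangle_ineq)
  also have "\<dots> \<le> r * ((\<Sum>j<k. r ^ j) * B) + B"
    using Suc f[of "S k"] w[of k] \<open>0 \<le> r\<close>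
    by (meson add_mono mult_left_mono order_trans)
  also have "\<dots> = (\<Sum>j<Suc k. r ^ j) * B"
    by (simp add: sum.lessThan_Suc_shift sum_distrib_left algebra_simps del: sum.lessThan_Suc)
  finally show ?case .
qed (simp add: assms)


section \<open>Convergence of the averaged implemented setpoints, with rate\<close>

theorem theorem1:
  fixes \<Gamma> :: "real ^ ('n::finite \<times> 2) ^ ('n \<times> 2)"
    and \<gamma> :: "real ^ ('n \<times> 2)"
    and a \<alpha> :: real
    and J :: "real ^ ('n \<times> 2) \<Rightarrow> real"
    and U :: "(real ^ ('n \<times> 2)) set"
    and P :: "real ^ ('n \<times> 2) \<Rightarrow> real ^ ('n \<times> 2)"
    and x y :: "nat \<Rightarrow> real ^ ('n \<times> 2)"
    and c :: "real ^ 'n"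
  assumes "symmetric_positive_definite \<Gamma>"
    and "J = quadratic_objective \<Gamma> \<gamma> a"
    and "U \<noteq> {}" and "closed U"
    and "projection_onto U P"
    and "0 < \<alpha>" and "\<alpha> \<le> 1 / spectral_radius \<Gamma>"
    and "\<And>k. k \<ge> 1 \<Longrightarrow> x (k + 1) = P (y k - \<alpha> *\<^sub>R gradient J (y k))"
    and "\<And>k. k \<ge> 1 \<Longrightarrow> y k - \<alpha> *\<^sub>R gradient J (y k) \<in> U"
    and "\<And>i. 0 \<le> c $ i"
    and "\<And>i. bounded_accumulated_error (c $ i) (\<lambda>k. block i (y k)) (\<lambda>k. block i (x k))"
  shows "let xstar = - (matrix_inv \<Gamma> *v \<gamma>);
             r = spectral_radius (mat 1 - \<alpha> *\<^sub>R \<Gamma>);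
             \<psi> = x 1 + (2 * \<alpha>) *\<^sub>R \<gamma> - \<alpha>\<^sup>2 *\<^sub>R (\<Gamma> *v \<gamma>)
         in (\<forall>z. is_arg_min J (\<lambda>_. True) z \<longleftrightarrow> z = xstar)
          \<and> (\<lambda>k. (1 / real k) *\<^sub>R (\<Sum>i=1..k. y i)) \<longlonglongrightarrow> xstar
          \<and> r < 1
          \<and> (\<forall>k\<ge>1. norm ((1 / real k) *\<^sub>R (\<Sum>i=1..k. y i) - xstar)
                 \<le> (1 - r ^ k) / (real k * (1 - r))
                   * (norm \<psi> + op_norm (matrix_inv \<Gamma>) * norm \<gamma> * r\<^sup>2 + norm c))"
proof -
  define s where "s = - (matrix_inv \<Gamma> *v \<gamma>)"
  define A where "A = mat 1 - \<alpha> *\<^sub>R \<Gamma>"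
  define r where "r = spectral_radius A"
  define \<psi> where "\<psi> = x 1 + (2 * \<alpha>) *\<^sub>R \<gamma> - \<alpha>\<^sup>2 *\<^sub>R (\<Gamma> *v \<gamma>)"
  define B where "B = norm \<psi> + op_norm (matrix_inv \<Gamma>) * norm \<gamma> * r\<^sup>2 + norm c"
  have sym: "transpose \<Gamma> = \<Gamma>" and pos: "\<And>v. v \<noteq> 0 \<Longrightarrow> v \<bullet> (\<Gamma> *v v) > 0"
    using assms(1) by (auto simp: symmetric_positive_definite_def)
  have \<Gamma>inv: "\<Gamma> *v (matrix_inv \<Gamma> *v \<gamma>) = \<gamma>"
    by (rule symmetric_positive_definite_mult_matrix_inv[OF assms(1)])
  have \<Gamma>s: "\<Gamma> *v s = - \<gamma>"
    unfolding s_def using \<Gamma>inv by (metis matrix_vector_mult_diff_distrib diff_0 matrix_vector_mult_0_right)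
  have A: "A *v v = v - \<alpha> *\<^sub>R (\<Gamma> *v v)" for v
    unfolding A_def by (simp add: matrix_vector_mult_diff_rdistrib scaleR_matrix_vector_assoc)
  have symA: "transpose A = A"
    using sym by (simp add: A_def vec_eq_iff transpose_def mat_def)
  have normA: "norm (A *v v) \<le> r * norm v" for v
    unfolding r_def by (rule norm_le_spectral_radius[OF symA])

  \<comment> \<open>An eigenvalue l of \<open>A\<close> of largest modulus has the form 1 - \<alpha>
    m with m an eigenvalue of \<Gamma>. The step size gives 0 < \<alpha> m \<le> 1, so l lies in [0,
    1).\<close>
  have r: "0 \<le> r" "r < 1"
  proof -
    obtain l where l: "real_eigenvalue A l" "r = \<bar>l\<bar>"
      using spectral_radius_attained[OF symA] by (auto simp: r_def)
    obtain v where v: "v \<noteq> 0" "A *v v = l *\<^sub>R v"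
      using l(1) by (auto simp: real_eigenvalue_def)
    define m where "m = (1 - l) / \<alpha>"
    have "\<alpha> *\<^sub>R (\<Gamma> *v v) = (1 - l) *\<^sub>R v"
      using v(2) by (simp add: A algebra_simps)
    then have "\<Gamma> *v v = m *\<^sub>R v"
      using \<open>0 < \<alpha>\<close> unfolding m_def
      by (metis (no_types, lifting) divide_inverse_commute less_irrefl scaleR_scaleR left_inverse scaleR_one)
    then have "0 < m * (v \<bullet> v)" and m: "real_eigenvalue \<Gamma> m"
      using v(1) pos[OF v(1)] by (auto simp: real_eigenvalue_def)
    then have "m > 0"
      by (metis inner_ge_zero mult_nonpos_nonneg not_le)
    have "m \<le> spectral_radius \<Gamma>"
      using real_eigenvalue_le_spectral_radius[OF sym m] \<open>m > 0\<close> by simp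
    then have "\<alpha> * m \<le> 1"
      using assms(7) \<open>m > 0\<close> \<open>0 < \<alpha>\<close>
      by (smt (verit) divide_le_eq_1 le_divide_eq mult_left_mono)
    moreover have "\<alpha> * m = 1 - l"
      using \<open>0 < \<alpha>\<close> by (simp add: m_def)
    moreover have "0 < \<alpha> * m"
      using \<open>m > 0\<close> \<open>0 < \<alpha>\<close> by simp
    ultimately show "0 \<le> r" "r < 1"
      using l(2) by auto
  qed

  \<comment> \<open>The gradient step already lies in \<open>U\<close>, so the projection leaves it
    unchanged and the update is affine.\<close>
  have step: "x (Suc k) = A *v y k - \<alpha> *\<^sub>R \<gamma>" if "k \<ge> 1" for k
  proof -
    have "x (k + 1) = y k - \<alpha> *\<^sub>R gradient J (y k)"
      using assms(8,9)[OF that] projection_onto_fixes[OF assms(5)] by simp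
    then show ?thesis
      by (simp add: assms(2) gradient_quadratic_objective[OF sym] A algebra_simps)
  qed

  define E where "E k = (\<Sum>j=1..k. y j - x j)" for k
  have E: "norm (E k) \<le> norm c" if "k \<ge> 1" for k
    using assms(11) that unfolding E_def bounded_accumulated_error_def
    by (intro norm_le_of_blocks) (simp add: block_sum block_diff)
  define S where "S k = (\<Sum>j=1..k. y j - s)" for k
  \<comment> \<open>Equivalently, \<open>s\<close> is the fixed point of the affine map v \<mapsto>
    A v - \<alpha> \<gamma>.\<close>
  have As: "A *v s = s + \<alpha> *\<^sub>R \<gamma>"
    by (simp add: A \<Gamma>s)
  have S_Suc: "S (Suc k) = A *v S k + (x 1 - s + E (Suc k))" for k
  proof (induction k)
    case (Suc k)
    \<comment> \<open>The new deviation splits into its requested part, which is \<open>A\<close>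
      applied to the previous deviation and joins \<open>A *v S k\<close>, and the newest
      implementation error, which extends \<open>E\<close>.\<close>
    have "S (Suc (Suc k)) = S (Suc k) + (x (Suc (Suc k)) - s) + (y (Suc (Suc k)) - x (Suc (Suc k)))"
      by (simp add: S_def)
    also have "x (Suc (Suc k)) - s = A *v (y (Suc k) - s)"
      by (simp add: step As matrix_vector_mult_diff_distrib)
    also have "S (Suc k) + A *v (y (Suc k) - s) + (y (Suc (Suc k)) - x (Suc (Suc k)))
        = A *v (S k + (y (Suc k) - s)) + (x 1 - s + E (Suc (Suc k)))"
      unfolding Suc by (simp add: E_def matrix_vector_right_distrib algebra_simps)
    also have "S k + (y (Suc k) - s) = S (Suc k)"
      by (simp add: S_def)
    finally show ?case .
  qed (simp add: S_def E_def)

  have offset: "norm (x 1 - s) \<le> norm \<psi> + op_norm (matrix_inv \<Gamma>) * norm \<gamma> * r\<^sup>2"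
  proof -
    \<comment> \<open>With g = \<Gamma>^(-1) \<gamma>, applying \<open>A\<close> twice gives g - 2
      \<alpha> \<gamma> + \<alpha>^2 \<Gamma> \<gamma>, and the last two terms cancel against those
      in \<psi>. The two factors \<open>A\<close> produce r^2 in the bound.\<close>
    have "x 1 - s = \<psi> + A *v (A *v (matrix_inv \<Gamma> *v \<gamma>))"
      by (simp add: A \<Gamma>inv \<psi>_def s_def matrix_vector_mult_diff_distrib matrix_vector_mult_scaleR
          power2_eq_square algebra_simps flip: scaleR_2)
    moreover have "norm (A *v (A *v (matrix_inv \<Gamma> *v \<gamma>))) \<le> r * (r * (op_norm (matrix_inv \<Gamma>) * norm \<gamma>))"
    proof -
      have "norm (matrix_inv \<Gamma> *v \<gamma>) \<le> op_norm (matrix_inv \<Gamma>) * norm \<gamma>"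
        unfolding op_norm_def by (rule onorm) simp
      then show ?thesis
        using normA r(1) by (meson mult_left_mono order_trans)
    qed
    ultimately show ?thesis
      using norm_triangle_ineq[of \<psi> "A *v (A *v (matrix_inv \<Gamma> *v \<gamma>))"]
      by (simp add: power2_eq_square algebra_simps)
  qed
  have "norm (x 1 - s + E (Suc k)) \<le> B" for k
    using norm_triangle_ineq[of "x 1 - s" "E (Suc k)"] offset E[of "Suc k"] by (simp add: B_def)
  then have S_bound: "norm (S k) \<le> (\<Sum>j<k. r ^ j) * B" for k
    using perturbed_contraction_bound[where S = S and f = "(*v) A", OF r(1) normA _ S_Suc]
    by (simp add: S_def)
  \<comment> \<open>For k = 1 the geometric sum is 1, so \<open>B\<close> dominates a norm.\<close>
  have B: "0 \<le> B"
    using order_trans[OF norm_ge_zero S_bound[of 1]] by simp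

  \<comment> \<open>For k = 0 the left side would be -s, since 1 / 0 = 0.\<close>
  have avg: "(1 / real k) *\<^sub>R (\<Sum>i=1..k. y i) - s = (1 / real k) *\<^sub>R S k" if "k \<ge> 1" for k
    using that by (simp add: S_def sum_subtractf scaleR_right_diff_distrib
        sum_constant_scaleR del: sum_constant)
  have bound: "norm ((1 / real k) *\<^sub>R (\<Sum>i=1..k. y i) - s) \<le> (1 - r ^ k) / (real k * (1 - r)) * B"
    if "k \<ge> 1" for k
  proof -
    have geo: "(\<Sum>j<k. r ^ j) = (1 - r ^ k) / (1 - r)"
      using r(2) by (simp add: sum_gp_strict)
    have "norm ((1 / real k) *\<^sub>R S k) \<le> (1 / real k) * ((1 - r ^ k) / (1 - r) * B)"
      using mult_left_mono[OF S_bound[of k], of "1 / real k"] by (simp add: geo)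
    then show ?thesis
      unfolding avg[OF that] by (simp add: field_simps)
  qed
  have "(\<lambda>k. (1 / real k) *\<^sub>R (\<Sum>i=1..k. y i) - s) \<longlonglongrightarrow> 0"
  proof (rule Lim_null_comparison)
    \<comment> \<open>Dropping the nonnegative r^k leaves a constant multiple of 1/k, which gives
      the limit.\<close>
    have "(1 - r ^ k) / (real k * (1 - r)) * B \<le> B / (1 - r) * (1 / real k)" if "k \<ge> 1" for k
    proof -
      have "(1 - r ^ k) * B \<le> 1 * B"
        using r(1) B by (intro mult_right_mono) auto
      then show ?thesis
        using that r(2) by (simp add: divide_simps mult.commute)
    qed
    then show "\<forall>\<^sub>F k in sequentially. norm ((1 / real k) *\<^sub>R (\<Sum>i=1..k. y i) - s) \<le> B / (1 - r) * (1 / real k)"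
      using bound unfolding eventually_sequentially by (meson order_trans)
    show "(\<lambda>k. B / (1 - r) * (1 / real k)) \<longlonglongrightarrow> 0"
      by (intro tendsto_mult_right_zero lim_1_over_n)
  qed
  then have "(\<lambda>k. (1 / real k) *\<^sub>R (\<Sum>i=1..k. y i)) \<longlonglongrightarrow> s"
    by (rule Lim_null[THEN iffD2])
  then show ?thesis
    using is_arg_min_quadratic_objective[OF assms(1) \<Gamma>s] bound r(2)
    unfolding Let_def assms(2) s_def[symmetric] A_def[symmetric] r_def[symmetric]
      \<psi>_def[symmetric] B_def[symmetric]
    by blast
qed

end
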